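(* Let $\widetilde A=(\widetilde a_{ij})\in\mathbb{R}^{n\times n}$ be symmetric positive definite, and suppose that $$\theta:=\frac{\mathrm{off}(\widetilde A)}{\min_i\widetilde a_{ii}}<1 .$$ Then $\widetilde A$ is $\theta$-scaled diagonally dominant with respect to $\|\cdot\|_2$, and $$\kappa_2^S(\widetilde A)\le\frac{1+\theta}{1-\theta}.$$ In particular, if $\mathrm{off}(\widetilde A)/\min_i\widetilde a_{ii}<1/2$, then $\kappa_2^S(\widetilde A)<3$.
   Context: $\mathrm{off}(B)=\bigl(\sum_{i\ne j}b_{ij}^2\bigr)^{1/2}=\|B-\mathrm{diag}(B)\|_F$, where $\mathrm{diag}(B)$ is the diagonal part of $B$. A symmetric positive definite matrix $\widetilde A$ is $\theta$-scaled diagonally dominant with respect to $\|\cdot\|_2$ if $\|\widetilde D\widetilde A\widetilde D-I\|_2\le\theta<1$, where $\widetilde D=\mathrm{diag}(\widetilde a_{ii}^{-1/2})$. For symmetric positive definite $B$, $\kappa_2(B)=\lambda_{\max}(B)/\lambda_{\min}(B)$ and the scaled condition number is $\kappa_2^S(B)=\kappa_2(DBD)$ with $D=\mathrm{diag}(b_{ii}^{-1/2})$. *)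

theory Defs
  imports "HOL-Analysis.Analysis"
begin

definition sym_pos_def :: "real^'n^'n \<Rightarrow> bool" where
  "sym_pos_def B \<longleftrightarrow> transpose B = B \<and> (\<forall>x. x \<noteq> 0 \<longrightarrow> x \<bullet> (B *v x) > 0)"

definition diag_matrix :: "('n \<Rightarrow> real) \<Rightarrow> real^'n^'n" where
  "diag_matrix d = (\<chi> i j. if i = j then d i else 0)"

definition off :: "real^'n^'n \<Rightarrow> real" where
  "off B = sqrt (\<Sum>(i, j)\<in>{(i, j). i \<noteq> j}. (B $ i $ j)\<^sup>2)"

text \<open>The library norm on \<^typ>\<open>real^'n^'n\<close> is the Frobenius norm.\<close>

lemma off_eq_norm: "off B = norm (B - diag_matrix (\<lambda>i. B $ i $ i))"
proof -
  have "(\<Sum>(i, j)\<in>{(i, j). i \<noteq> j}. (B $ i $ j)\<^sup>2)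
      = (\<Sum>(i, j)\<in>UNIV. ((B - diag_matrix (\<lambda>i. B $ i $ i)) $ i $ j)\<^sup>2)"
    by (rule sum.mono_neutral_cong_left) (auto simp: diag_matrix_def)
  also have "\<dots> = (\<Sum>i\<in>UNIV. \<Sum>j\<in>UNIV. ((B - diag_matrix (\<lambda>i. B $ i $ i)) $ i $ j)\<^sup>2)"
    by (simp add: sum.cartesian_product)
  finally show ?thesis
    by (simp add: off_def norm_vec_def L2_set_def sum_nonneg)
qed

definition norm2 :: "real^'n^'n \<Rightarrow> real" where
  "norm2 B = onorm ((*v) B)"

definition scaling :: "real^'n^'n \<Rightarrow> real^'n^'n" where
  "scaling B = diag_matrix (\<lambda>i. (B $ i $ i) powr (- 1 / 2))"

definition scaled_diag_dominant :: "real \<Rightarrow> real^'n^'n \<Rightarrow> bool" where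
  "scaled_diag_dominant \<theta> B \<longleftrightarrow>
     sym_pos_def B \<and> norm2 (scaling B ** B ** scaling B - mat 1) \<le> \<theta> \<and> \<theta> < 1"

text \<open>
  Only real eigenvalues are collected. For the symmetric matrices considered here these are all
  the eigenvalues; the set is then finite and nonempty, so that \<^const>\<open>Max\<close> and \<^const>\<open>Min\<close>
  are meaningful.
\<close>

definition eigenvalues :: "real^'n^'n \<Rightarrow> real set" where
  "eigenvalues B = {l. \<exists>v. v \<noteq> 0 \<and> B *v v = l *\<^sub>R v}"

definition lambda_max :: "real^'n^'n \<Rightarrow> real" where
  "lambda_max B = Max (eigenvalues B)"

definition lambda_min :: "real^'n^'n \<Rightarrow> real" where
  "lambda_min B = Min (eigenvalues B)"

definition kappa2 :: "real^'n^'n \<Rightarrow> real" where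
  "kappa2 B = lambda_max B / lambda_min B"

definition scaled_kappa2 :: "real^'n^'n \<Rightarrow> real" where
  "scaled_kappa2 B = kappa2 (scaling B ** B ** scaling B)"

end

theory Submission
  imports Defs
begin

text \<open>
  Let \<open>m\<close> be the smallest diagonal entry of \<open>A\<close>, let \<open>D\<close> be the scaling and \<open>E = D A D - I\<close>.
  The scaling makes the diagonal of \<open>D A D\<close> equal to \<open>1\<close>, so \<open>E\<close> vanishes on the diagonal, and an
  off-diagonal entry of \<open>E\<close> is that of \<open>A\<close> divided by the geometric mean of two diagonal entries,
  which is at least \<open>m\<close>. Hence \<open>E\<close> is dominated entry by entry by \<open>1 / m\<close> times the off-diagonal
  part of \<open>A\<close>, and its Frobenius norm, which bounds its spectral norm, is at most
  \<open>off A / m = \<theta>\<close> (lemma \<open>norm2_scaled_defect_le\<close>).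

  A real eigenvalue of \<open>I + E\<close> differs from \<open>1\<close> by at most the spectral norm of \<open>E\<close>
  (lemma \<open>eigenvalue_near_one\<close>), so all eigenvalues of \<open>D A D\<close> lie between \<open>1 - \<theta>\<close> and \<open>1 + \<theta>\<close>.
  The condition number is defined through a maximum and a minimum of a set, so to conclude it must be
  known that a symmetric matrix has at least one and at most finitely many real eigenvalues. The
  former comes from maximizing the quadratic form over the unit sphere
  (lemma \<open>eigenvalues_nonempty\<close>), the latter from orthogonality of eigenvectors
  (lemma \<open>finite_eigenvalues\<close>).
\<close>

section \<open>Real eigenvalues of symmetric matrices\<close>

lemma symmetric_inner_commute:
  fixes B :: "real^'n^'n"
  assumes "transpose B = B"
  shows "x \<bullet> (B *v y) = (B *v x) \<bullet> y"
  using dot_lmul_matrix[of x B y] assms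
  by (metis transpose_matrix_vector)

text \<open>
  Eigenvectors to distinct eigenvalues of a symmetric matrix are orthogonal, hence linearly
  independent, and a finite-dimensional space has room for only finitely many of them.
\<close>

lemma finite_eigenvalues:
  fixes B :: "real^'n^'n"
  assumes sym: "transpose B = B"
  shows "finite (eigenvalues B)"
proof -
  have "\<forall>l\<in>eigenvalues B. \<exists>v. v \<noteq> 0 \<and> B *v v = l *\<^sub>R v"
    by (simp add: eigenvalues_def)
  then obtain f where f: "\<And>l. l \<in> eigenvalues B \<Longrightarrow> f l \<noteq> 0 \<and> B *v f l = l *\<^sub>R f l"
    by metis
  have orth: "f l \<bullet> f k = 0" if "l \<in> eigenvalues B" "k \<in> eigenvalues B" "l \<noteq> k" for l k
  proof -
    have "k * (f l \<bullet> f k) = l * (f l \<bullet> f k)"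
      using symmetric_inner_commute[OF sym, of "f l" "f k"] f that by simp
    then show ?thesis using that by simp
  qed
  have "inj_on f (eigenvalues B)"
    by (rule inj_onI) (metis f inner_eq_zero_iff orth)
  moreover have "pairwise orthogonal (f ` eigenvalues B)"
    by (auto simp: pairwise_def orthogonal_def intro: orth)
  moreover have "0 \<notin> f ` eigenvalues B"
    using f by fastforce
  ultimately show ?thesis
    using pairwise_orthogonal_independent independent_imp_finite finite_imageD by blast
qed

text \<open>
  A null vector of the quadratic form of a positive semidefinite \<open>N\<close> lies in the kernel: otherwise
  moving from \<open>x\<close> a small step against \<open>N x\<close> would make the form negative, because the change is
  of first order in the step.
\<close>

lemma psd_null_vector:
  fixes N :: "real^'n^'n"
  assumes sym: "transpose N = N"
    and psd: "\<And>y. 0 \<le> y \<bullet> (N *v y)"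
    and null: "x \<bullet> (N *v x) = 0"
  shows "N *v x = 0"
proof (rule ccontr)
  define z where "z = N *v x"
  define q where "q = z \<bullet> (N *v z)"
  assume "N *v x \<noteq> 0"
  then have z: "z \<bullet> z > 0" by (simp add: z_def)
  have q: "q \<ge> 0" using psd by (simp add: q_def)
  have expand: "(x + t *\<^sub>R z) \<bullet> (N *v (x + t *\<^sub>R z)) = t * (2 * (z \<bullet> z) + t * q)" for t
    using null symmetric_inner_commute[OF sym, of x z]
    by (simp add: matrix_vector_right_distrib matrix_vector_mult_scaleR inner_add_left
        inner_add_right q_def z_def[symmetric] algebra_simps power2_eq_square)
  define t where "t = - (z \<bullet> z) / (q + 1)"
  have t: "t < 0" using z q by (simp add: t_def divide_neg_pos)
  have "t * q \<ge> - (z \<bullet> z)"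
    using z q by (simp add: t_def field_simps)
  then have "2 * (z \<bullet> z) + t * q > 0" using z by linarith
  then have "t * (2 * (z \<bullet> z) + t * q) < 0" using t by (simp add: mult_neg_pos)
  then show False using psd[of "x + t *\<^sub>R z"] expand[of t] by simp
qed

text \<open>
  The maximum \<open>l\<close> of the quadratic form on the unit sphere is an eigenvalue: \<open>l I - B\<close> is positive
  semidefinite by homogeneity, and a maximizer is a null vector of its quadratic form.
\<close>

lemma eigenvalues_nonempty:
  fixes B :: "real^'n^'n"
  assumes sym: "transpose B = B"
  shows "eigenvalues B \<noteq> {}"
proof -
  have cont: "continuous_on (sphere 0 1) (\<lambda>x::real^'n. x \<bullet> (B *v x))"
    by (intro continuous_intros)
  obtain x where x: "x \<in> sphere 0 1"
    and max: "\<And>y. y \<in> sphere 0 1 \<Longrightarrow> y \<bullet> (B *v y) \<le> x \<bullet> (B *v x)"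
    using continuous_attains_sup[OF compact_sphere _ cont] by force
  define l where "l = x \<bullet> (B *v x)"
  define N where "N = mat l - B"
  have mat: "mat l *v y = l *\<^sub>R y" for y :: "real^'n"
    by (simp add: vec_eq_iff matrix_vector_mult_def mat_def if_distrib[of "\<lambda>u. u * _"] cong: if_cong)
  have N: "N *v y = l *\<^sub>R y - B *v y" for y
    by (simp add: N_def matrix_vector_mult_diff_rdistrib mat)
  have "N *v x = 0"
  proof (rule psd_null_vector)
    show "transpose N = N"
      using sym by (auto simp: N_def transpose_def mat_def vec_eq_iff)
    show "x \<bullet> (N *v x) = 0"
      using x by (simp add: N inner_diff_right l_def norm_eq_1)
    show "0 \<le> y \<bullet> (N *v y)" for y
    proof (cases "y = 0")
      case False
      define u where "u = y /\<^sub>R norm y"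
      have y: "y = norm y *\<^sub>R u" using False by (simp add: u_def)
      have u: "u \<in> sphere 0 1" using False by (simp add: u_def)
      then have "0 \<le> u \<bullet> (N *v u)"
        using max[OF u] by (simp add: N inner_diff_right l_def norm_eq_1)
      then have "0 \<le> (norm y *\<^sub>R u) \<bullet> (N *v (norm y *\<^sub>R u))"
        by (simp add: matrix_vector_mult_scaleR)
      then show ?thesis using y by simp
    qed simp
  qed
  then have "B *v x = l *\<^sub>R x" by (simp add: N)
  moreover have "x \<noteq> 0" using x by auto
  ultimately show ?thesis by (auto simp: eigenvalues_def)
qed

section \<open>Norm bounds\<close>

lemma matrix_vector_mult_norm_le:
  fixes B :: "real^'n^'m"
  shows "norm (B *v x) \<le> norm B * norm x"
proof -
  have "norm (B *v x) \<le> L2_set (\<lambda>i. norm (B $ i) * norm x) UNIV"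
    unfolding norm_vec_def[of "B *v x"]
    by (rule L2_set_mono) (simp_all add: matrix_vector_mul_component Cauchy_Schwarz_ineq2)
  also have "\<dots> = norm B * norm x"
    by (simp add: norm_vec_def[of B] L2_set_left_distrib)
  finally show ?thesis .
qed

lemma norm2_le_norm: "norm2 B \<le> norm B"
  unfolding norm2_def by (rule onorm_bound) (simp_all add: matrix_vector_mult_norm_le)

lemma eigenvalue_near_one:
  fixes B :: "real^'n^'n"
  assumes "l \<in> eigenvalues B"
  shows "\<bar>l - 1\<bar> \<le> norm2 (B - mat 1)"
proof -
  obtain v where v: "v \<noteq> 0" "B *v v = l *\<^sub>R v"
    using assms by (auto simp: eigenvalues_def)
  have "(B - mat 1) *v v = (l - 1) *\<^sub>R v"
    using v by (simp add: matrix_vector_mult_diff_rdistrib scaleR_left_diff_distrib)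
  then have "\<bar>l - 1\<bar> * norm v = norm ((B - mat 1) *v v)" by simp
  also have "\<dots> \<le> norm2 (B - mat 1) * norm v"
    unfolding norm2_def by (rule onorm) simp
  finally show ?thesis using v by simp
qed

lemma kappa2_le:
  fixes B :: "real^'n^'n"
  assumes sym: "transpose B = B" and E: "norm2 (B - mat 1) \<le> \<theta>" and "\<theta> < 1"
  shows "kappa2 B \<le> (1 + \<theta>) / (1 - \<theta>)"
proof -
  note fin = finite_eigenvalues[OF sym] and ne = eigenvalues_nonempty[OF sym]
  have "\<bar>l - 1\<bar> \<le> \<theta>" if "l \<in> eigenvalues B" for l
    using eigenvalue_near_one[OF that] E by simp
  then have "\<bar>lambda_max B - 1\<bar> \<le> \<theta>" "\<bar>lambda_min B - 1\<bar> \<le> \<theta>"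
    using Max_in[OF fin ne] Min_in[OF fin ne] by (auto simp: lambda_max_def lambda_min_def)
  then show ?thesis
    unfolding kappa2_def using \<open>\<theta> < 1\<close> by (intro frac_le) auto
qed

section \<open>The scaled matrix\<close>

lemma powr_neg_half_mult_self:
  fixes x :: real
  assumes "0 < x"
  shows "x powr (- 1 / 2) * x powr (- 1 / 2) = 1 / x"
proof -
  have "x powr (- 1 / 2) * x powr (- 1 / 2) = x powr (- 1)"
    unfolding powr_add[symmetric] by simp
  also have "\<dots> = 1 / x" using assms by (simp add: powr_minus_divide)
  finally show ?thesis .
qed

lemma scaled_component:
  "(scaling A ** A ** scaling A) $ i $ j
    = (A $ i $ i) powr (- 1 / 2) * A $ i $ j * (A $ j $ j) powr (- 1 / 2)"
proof -
  have "(scaling A ** A) $ i $ k = (A $ i $ i) powr (- 1 / 2) * A $ i $ k" for k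
    by (simp add: matrix_matrix_mult_def scaling_def diag_matrix_def
        if_distrib[of "\<lambda>u. u * _"] cong: if_cong)
  moreover have "(scaling A ** A ** scaling A) $ i $ j
      = (\<Sum>k\<in>UNIV. (scaling A ** A) $ i $ k * scaling A $ k $ j)"
    by (subst matrix_matrix_mult_def) simp
  ultimately have "(scaling A ** A ** scaling A) $ i $ j
      = (\<Sum>k\<in>UNIV. (A $ i $ i) powr (- 1 / 2) * A $ i $ k * scaling A $ k $ j)"
    by (simp only:)
  then show ?thesis
    by (simp add: scaling_def diag_matrix_def if_distrib[of "\<lambda>u. a * u" for a] cong: if_cong)
qed

lemma transpose_scaled:
  assumes "transpose A = A"
  shows "transpose (scaling A ** A ** scaling A) = scaling A ** A ** scaling A"
proof -
  have "A $ i $ j = A $ j $ i" for i j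
    using assms by (metis transpose_def vec_lambda_beta)
  then show ?thesis
    by (simp add: vec_eq_iff transpose_def scaled_component ac_simps)
qed

lemma sym_pos_def_diag_pos:
  assumes "sym_pos_def A"
  shows "0 < A $ i $ i"
proof -
  have "axis i 1 \<bullet> (A *v axis i 1) > 0"
    using assms by (simp add: sym_pos_def_def axis_eq_0_iff)
  then show ?thesis
    by (simp add: inner_axis' matrix_vector_mult_basis column_def)
qed

text \<open>
  Both factors scaling an off-diagonal entry are at most \<open>m powr (- 1 / 2)\<close>, so the comparison
  of Frobenius norms with \<open>1 / m\<close> times the off-diagonal part of \<open>A\<close> holds entry by entry.
\<close>

lemma norm2_scaled_defect_le:
  fixes A :: "real^'n^'n"
  assumes m: "0 < m" and diag: "\<And>i. m \<le> A $ i $ i"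
  shows "norm2 (scaling A ** A ** scaling A - mat 1) \<le> off A / m"
proof -
  let ?E = "scaling A ** A ** scaling A - mat 1"
  let ?F = "(1 / m) *\<^sub>R (A - diag_matrix (\<lambda>i. A $ i $ i))"
  have pos: "0 < A $ i $ i" for i using m diag[of i] by linarith
  have entry: "norm (?E $ i $ j) \<le> norm (?F $ i $ j)" for i j
  proof (cases "i = j")
    case True
    have "(A $ i $ i) powr (- 1 / 2) * (A $ i $ i) powr (- 1 / 2) * A $ i $ i = 1"
      unfolding powr_neg_half_mult_self[OF pos] using pos[of i] by simp
    then show ?thesis
      using True by (simp add: scaled_component mat_def ac_simps)
  next
    case False
    have small: "(A $ k $ k) powr (- 1 / 2) \<le> m powr (- 1 / 2)" for k
      using m diag[of k] by (intro powr_mono2') auto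
    have "(A $ i $ i) powr (- 1 / 2) * (A $ j $ j) powr (- 1 / 2)
        \<le> m powr (- 1 / 2) * m powr (- 1 / 2)"
      by (intro mult_mono small) auto
    also have "\<dots> = 1 / m"
      using m by (rule powr_neg_half_mult_self)
    finally have "(A $ i $ i) powr (- 1 / 2) * (A $ j $ j) powr (- 1 / 2) * \<bar>A $ i $ j\<bar>
        \<le> 1 / m * \<bar>A $ i $ j\<bar>"
      by (rule mult_right_mono) simp
    then show ?thesis
      using False m by (simp add: scaled_component mat_def diag_matrix_def abs_mult ac_simps)
  qed
  have "norm2 ?E \<le> norm ?E" by (rule norm2_le_norm)
  also have "\<dots> \<le> norm ?F"
    by (intro norm_le_componentwise_cart entry)
  also have "\<dots> = off A / m"
    using m by (simp add: off_eq_norm)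
  finally show ?thesis .
qed

theorem mainTheorem2:
  fixes A :: "real^'n^'n" and \<theta> :: real
  assumes "sym_pos_def A"
    and "\<theta> = off A / (MIN i. A $ i $ i)"
    and "\<theta> < 1"
  shows "scaled_diag_dominant \<theta> A
    \<and> scaled_kappa2 A \<le> (1 + \<theta>) / (1 - \<theta>)
    \<and> (off A / (MIN i. A $ i $ i) < 1 / 2 \<longrightarrow> scaled_kappa2 A < 3)"
proof -
  have "0 < (MIN i. A $ i $ i)"
    using sym_pos_def_diag_pos[OF assms(1)] by simp
  then have E: "norm2 (scaling A ** A ** scaling A - mat 1) \<le> \<theta>"
    unfolding assms(2) by (rule norm2_scaled_defect_le) simp
  have "transpose A = A" using assms(1) by (simp add: sym_pos_def_def)
  then have K: "scaled_kappa2 A \<le> (1 + \<theta>) / (1 - \<theta>)"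
    unfolding scaled_kappa2_def by (intro kappa2_le transpose_scaled E assms(3))
  have "(1 + \<theta>) / (1 - \<theta>) < 3" if "\<theta> < 1 / 2"
    using that by (simp add: field_simps)
  then show ?thesis
    using K E assms by (auto simp: scaled_diag_dominant_def)
qed

end
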